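(* For any $i,j\in\mathbb{N}$, $i<j$ implies $\sim_{n[i]}\ \subsetneq\ \sim_{n[j]}$. That is, if $i<j$, then for every $n$, every inverse subsemigroup $S\le I_n$ and all $a,b\in S$, $a\sim_{n[i]}b$ implies $a\sim_{n[j]}b$; and there exist some $n$, some inverse subsemigroup $S\le I_n$ and elements $a,b\in S$ with $a\sim_{n[j]}b$ and $a\not\sim_{n[i]}b$.
   Context: $\mathbb{N}$ denotes the positive integers. $I_n$ is the semigroup (symmetric inverse monoid) of all bijections between subsets of $[n]=\{1,\dots,n\}$ under composition of partial functions, with functions acting on the right ($x(st)=(xs)t$). For $a\in I_n$, $a^{-1}$ is the inverse partial bijection and $a^{-k}=(a^{-1})^k$. For a semigroup $S$, $S^1$ is $S$ with an identity adjoined if it has none, and for $a,b\in S$, $a\sim_n b$ iff there exist $g,h\in S^1$ with $ag=gb$, $bh=ha$, $hag=b$ and $gbh=a$. For $k\in\mathbb{N}$, an inverse subsemigroup $S\le I_n$ (a subsemigroup closed under $a\mapsto a^{-1}$), and $a,b\in S$, define $a\sim_{n[k]}b$ in $S$ iff $a^{k+1}a^{-k}\sim_n b^{k+1}b^{-k}$ in $S$. *)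

theory Defs
  imports Main
begin

text \<open>
  Partial bijections of \<open>{1..n}\<close> are represented by their graphs. Since functions act on the
  right, the product \<open>s t\<close> is the relational composition \<open>s O t\<close>: \<open>(x, z) \<in> s O t\<close> iff \<open>s\<close> takes
  \<open>x\<close> to some \<open>y\<close> and \<open>t\<close> takes \<open>y\<close> to \<open>z\<close>. The inverse partial bijection is \<open>converse\<close>, and
  powers are the library's powers of relations.
\<close>

definition sym_inv_monoid :: "nat \<Rightarrow> (nat \<times> nat) set set" where
  "sym_inv_monoid n =
     {a. a \<subseteq> {1..n} \<times> {1..n} \<and> single_valued a \<and> single_valued (a\<inverse>)}"

definition inverse_subsemigroup :: "nat \<Rightarrow> (nat \<times> nat) set set \<Rightarrow> bool" where
  "inverse_subsemigroup n S \<longleftrightarrow>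
     S \<subseteq> sym_inv_monoid n \<and> (\<forall>a\<in>S. \<forall>b\<in>S. a O b \<in> S) \<and> (\<forall>a\<in>S. a\<inverse> \<in> S)"

definition has_identity :: "'a set \<Rightarrow> ('a \<Rightarrow> 'a \<Rightarrow> 'a) \<Rightarrow> bool" where
  "has_identity S m \<longleftrightarrow> (\<exists>e\<in>S. \<forall>x\<in>S. m e x = x \<and> m x e = x)"

text \<open>
  The semigroup \<open>S\<^sup>1\<close> lives in the option type: \<open>Some x\<close> stands for \<open>x \<in> S\<close>, and \<open>None\<close> for the
  adjoined identity, which is present only when \<open>S\<close> has no identity of its own. For instance,
  an \<open>S\<close> whose identity is a proper restriction of the identity of \<open>{1..n}\<close> gets no new element.
\<close>

definition carrier1 :: "'a set \<Rightarrow> ('a \<Rightarrow> 'a \<Rightarrow> 'a) \<Rightarrow> 'a option set" where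
  "carrier1 S m = (if has_identity S m then Some ` S else insert None (Some ` S))"

fun mult1 :: "('a \<Rightarrow> 'a \<Rightarrow> 'a) \<Rightarrow> 'a option \<Rightarrow> 'a option \<Rightarrow> 'a option" where
  "mult1 m None y = y"
| "mult1 m (Some x) None = Some x"
| "mult1 m (Some x) (Some y) = Some (m x y)"

definition nat_conj :: "'a set \<Rightarrow> ('a \<Rightarrow> 'a \<Rightarrow> 'a) \<Rightarrow> 'a \<Rightarrow> 'a \<Rightarrow> bool" where
  "nat_conj S m a b \<longleftrightarrow>
     a \<in> S \<and> b \<in> S \<and>
     (\<exists>g\<in>carrier1 S m. \<exists>h\<in>carrier1 S m.
        mult1 m (Some a) g = mult1 m g (Some b) \<and>
        mult1 m (Some b) h = mult1 m h (Some a) \<and>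
        mult1 m (mult1 m h (Some a)) g = Some b \<and>
        mult1 m (mult1 m g (Some b)) h = Some a)"

text \<open>
  The relation \<open>\<sim>\<^sub>n\<^sub>[\<^sub>k\<^sub>]\<close> on an inverse semigroup \<open>S\<close> of partial bijections, meant for \<open>k \<ge> 1\<close>.
  The letter \<open>n\<close> in its name is for ``natural'', and has nothing to do with \<open>{1..n}\<close>.
\<close>

definition nat_conj_k :: "(nat \<times> nat) set set \<Rightarrow> nat \<Rightarrow> (nat \<times> nat) set \<Rightarrow> (nat \<times> nat) set \<Rightarrow> bool"
  where
  "nat_conj_k S k a b \<longleftrightarrow>
     a \<in> S \<and> b \<in> S \<and>
     nat_conj S (O) (a ^^ (k + 1) O (a\<inverse>) ^^ k) (b ^^ (k + 1) O (b\<inverse>) ^^ k)"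

end

theory Submission
  imports Defs
begin

text \<open>
  Write \<open>c\<^sub>k(a) = a\<^sup>k\<^sup>+\<^sup>1 a\<^sup>-\<^sup>k\<close>. For a partial bijection \<open>a\<close>, following \<open>k + 1\<close> arrows of \<open>a\<close> and then
  going back along \<open>k\<close> of them amounts to taking a single arrow, so \<open>c\<^sub>k(a)\<close> is the restriction of
  \<open>a\<close> to the domain of \<open>a\<^sup>k\<^sup>+\<^sup>1\<close> (lemma \<open>relpow_Suc_converse_relpow_iff\<close>). Hence
  \<open>c\<^sub>k\<^sub>+\<^sub>1(a)\<close> is \<open>c\<^sub>k(a)\<close> with those arrows dropped that cannot be continued inside \<open>c\<^sub>k(a)\<close>; that is,
  \<open>c\<^sub>k\<^sub>+\<^sub>1(a) = c\<^sub>1(c\<^sub>k(a))\<close>.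

  Inclusion therefore reduces to the claim that \<open>a \<sim>\<^sub>n b\<close> implies \<open>c\<^sub>1(a) \<sim>\<^sub>n c\<^sub>1(b)\<close>. The conjugators
  \<open>g\<close> and \<open>h\<close> of \<open>a\<close> and \<open>b\<close>, restricted to the points that lie on arrows, are mutually inverse
  isomorphisms between the functional graphs of \<open>a\<close> and \<open>b\<close>, and an isomorphism preserves which arrows can be continued; so the same \<open>g\<close> and
  \<open>h\<close> conjugate \<open>c\<^sub>1(a)\<close> and \<open>c\<^sub>1(b)\<close> (lemmas \<open>intertwine_continuable\<close> and \<open>nat_conj_continuable\<close>).

  Strictness comes from nilpotent elements. The chain \<open>1 \<mapsto> 2 \<mapsto> \<dots> \<mapsto> i + 2\<close> has
  \<open>c\<^sub>i \<noteq> \<emptyset>\<close>, whereas \<open>c\<^sub>j = \<emptyset>\<close> for all \<open>j > i\<close>. As only the empty map is naturally conjugate to the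
  empty map, the chain and \<open>\<emptyset>\<close> are related by \<open>\<sim>\<^sub>n\<^sub>[\<^sub>j\<^sub>]\<close> but not by \<open>\<sim>\<^sub>n\<^sub>[\<^sub>i\<^sub>]\<close>.
\<close>

text \<open>
  The identity relation on the whole type is neutral for composition, so it can stand for the
  adjoined identity. This turns the equations in \<open>S\<^sup>1\<close> into plain equations between relations.
\<close>

fun rel_of_option :: "('a \<times> 'a) set option \<Rightarrow> ('a \<times> 'a) set" where
  "rel_of_option None = Id"
| "rel_of_option (Some g) = g"

lemma mult1_Some_left: "mult1 (O) (Some a) g = Some (a O rel_of_option g)"
  by (cases g) auto

lemma mult1_Some_right: "mult1 (O) g (Some a) = Some (rel_of_option g O a)"
  by (cases g) auto

lemma nat_conj_relcomp_iff:
  "nat_conj S (O) a b \<longleftrightarrow>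
     a \<in> S \<and> b \<in> S \<and>
     (\<exists>g\<in>rel_of_option ` carrier1 S (O). \<exists>h\<in>rel_of_option ` carrier1 S (O).
        a O g = g O b \<and> b O h = h O a \<and> h O a O g = b \<and> g O b O h = a)"
  unfolding nat_conj_def by (simp add: mult1_Some_left mult1_Some_right O_assoc)

lemma relcomp_relcomp_converse_iff:
  assumes "single_valued (r\<inverse>)"
  shows "(x, y) \<in> r O r O r\<inverse> \<longleftrightarrow> (x, y) \<in> r \<and> y \<in> Domain r"
  using assms by (auto simp: single_valued_def)

text \<open>
  Suppose \<open>(x, y) \<in> a\<close> and \<open>(y, z) \<in> g\<close>. If an arrow of \<open>a\<close> leaves \<open>y\<close>, then by \<open>g O b O h = a\<close> it
  passes through some \<open>g\<close>-image of \<open>y\<close> in the domain of \<open>b\<close>, and this image is \<open>z\<close>. Conversely, if an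
  arrow of \<open>b\<close> leaves \<open>z\<close>, then \<open>y\<close> is in the domain of \<open>g O b = a O g\<close>, so an arrow of \<open>a\<close>
  leaves \<open>y\<close>.
\<close>

lemma intertwine_continuable:
  assumes "single_valued (a\<inverse>)" "single_valued (b\<inverse>)"
    and "single_valued g" and ag: "a O g = g O b" and gbh: "g O b O h = a"
  shows "(a O a O a\<inverse>) O g = g O (b O b O b\<inverse>)"
proof -
  note a_iff = relcomp_relcomp_converse_iff[OF assms(1)]
    and b_iff = relcomp_relcomp_converse_iff[OF assms(2)]
  have "(x, z) \<in> (a O a O a\<inverse>) O g \<longleftrightarrow> (x, z) \<in> g O (b O b O b\<inverse>)" for x z
  proof
    assume "(x, z) \<in> (a O a O a\<inverse>) O g"
    then obtain y w where y: "(x, y) \<in> a" "(y, w) \<in> a" "(y, z) \<in> g"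
      using a_iff by blast
    have "(y, w) \<in> g O b O h" using y(2) gbh by simp
    then have "z \<in> Domain b"
      using y(3) assms(3) by (auto simp: single_valued_def)
    moreover have "(x, z) \<in> g O b" using y ag by blast
    ultimately show "(x, z) \<in> g O (b O b O b\<inverse>)"
      using b_iff by blast
  next
    assume "(x, z) \<in> g O (b O b O b\<inverse>)"
    then have "(x, z) \<in> g O b" and "z \<in> Domain b"
      using b_iff by blast+
    then obtain y w where y: "(x, y) \<in> a" "(y, z) \<in> g" "(z, w) \<in> b"
      using ag by blast
    then have "(y, w) \<in> a O g" using ag by blast
    then have "y \<in> Domain a" by blast
    then show "(x, z) \<in> (a O a O a\<inverse>) O g"
      using y a_iff by blast
  qed
  then show ?thesis by (simp only: set_eq_iff split_paired_All simp_thms)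
qed

lemma single_valued_rel_of_carrier1:
  assumes "inverse_subsemigroup n S" and "g \<in> rel_of_option ` carrier1 S (O)"
  shows "single_valued g"
  using assms
  by (auto simp: inverse_subsemigroup_def sym_inv_monoid_def carrier1_def split: if_splits)

text \<open>
  Both intertwining equations come from the preceding lemma. The other two follow from them since
  \<open>h O g\<close> fixes \<open>b\<close> from the left, and hence every product that begins with \<open>b\<close>; likewise for
  \<open>g O h\<close> and \<open>a\<close>.
\<close>

lemma nat_conj_continuable:
  assumes S: "inverse_subsemigroup n S" and "nat_conj S (O) a b"
  shows "nat_conj S (O) (a O a O a\<inverse>) (b O b O b\<inverse>)"
proof -
  let ?c = "a O a O a\<inverse>" and ?d = "b O b O b\<inverse>"
  from assms(2) obtain g h where ab: "a \<in> S" "b \<in> S"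
    and gh: "g \<in> rel_of_option ` carrier1 S (O)" "h \<in> rel_of_option ` carrier1 S (O)"
    and eq: "a O g = g O b" "b O h = h O a" "h O a O g = b" "g O b O h = a"
    unfolding nat_conj_relcomp_iff by blast
  have sv: "single_valued (a\<inverse>)" "single_valued (b\<inverse>)"
    using ab S by (auto simp: inverse_subsemigroup_def sym_inv_monoid_def)
  have svg: "single_valued g" "single_valued h"
    using single_valued_rel_of_carrier1[OF S] gh by auto
  have cg: "?c O g = g O ?d"
    using intertwine_continuable[OF sv svg(1) eq(1) eq(4)] .
  have dh: "?d O h = h O ?c"
    using intertwine_continuable[OF sv(2,1) svg(2) eq(2) eq(3)] .
  have hgb: "h O g O b = b" and gha: "g O h O a = a"
    using eq by simp_all
  have "h O ?c O g = (h O g O b) O b O b\<inverse>"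
    using cg by (simp only: O_assoc)
  then have hcg: "h O ?c O g = ?d" by (simp only: hgb)
  have "g O ?d O h = (g O h O a) O a O a\<inverse>"
    using dh by (simp only: O_assoc)
  then have gdh: "g O ?d O h = ?c" by (simp only: gha)
  have "?c \<in> S" "?d \<in> S"
    using ab S by (auto simp: inverse_subsemigroup_def)
  then show ?thesis
    unfolding nat_conj_relcomp_iff using gh cg dh hcg gdh by blast
qed

lemma converse_relpow: "(a\<inverse>) ^^ k = (a ^^ k)\<inverse>" for a :: "('a \<times> 'a) set"
proof (induction k)
  case (Suc k)
  have "(a\<inverse>) ^^ Suc k = a\<inverse> O (a\<inverse>) ^^ k"
    by (simp only: relpow.simps relpow_commute)
  then show ?case using Suc by (simp add: converse_relcomp)
qed simp

lemma relpow_Suc_converse_relpow_iff: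
  fixes a :: "('a \<times> 'a) set"
  assumes "single_valued (a\<inverse>)"
  shows "(x, y) \<in> a ^^ (k + 1) O (a\<inverse>) ^^ k \<longleftrightarrow> (x, y) \<in> a \<and> y \<in> Domain (a ^^ k)"
proof -
  have "single_valued ((a ^^ k)\<inverse>)"
    using single_valued_relpow[OF assms, of k] by (simp add: converse_relpow)
  moreover have "a ^^ (k + 1) = a O a ^^ k"
    by (simp add: relpow_commute)
  ultimately show ?thesis
    by (auto simp: converse_relpow single_valued_def)
qed

text \<open>
  An arrow of \<open>c k\<close> ending in \<open>y\<close> can be continued inside \<open>c k\<close> iff \<open>k + 1\<close> arrows of \<open>a\<close> can be
  followed from \<open>y\<close>, which is the condition for the arrow to belong to \<open>c (Suc k)\<close>.
\<close>

lemma relpow_converse_relpow_step: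
  fixes a :: "('a \<times> 'a) set"
  assumes "single_valued (a\<inverse>)"
  defines "c \<equiv> \<lambda>k. a ^^ (k + 1) O (a\<inverse>) ^^ k"
  shows "c (Suc k) = c k O c k O (c k)\<inverse>"
proof -
  have c_iff: "(x, y) \<in> c l \<longleftrightarrow> (x, y) \<in> a \<and> y \<in> Domain (a ^^ l)" for x y l
    unfolding c_def by (rule relpow_Suc_converse_relpow_iff[OF assms(1)])
  have "single_valued ((c k)\<inverse>)"
    using assms(1) by (auto simp: c_iff single_valued_def)
  have "a ^^ Suc k = a O a ^^ k"
    by (simp add: relpow_commute)
  then have Dom: "y \<in> Domain (a ^^ Suc k) \<longleftrightarrow> y \<in> Domain (c k)" for y
    by (auto simp: c_iff Domain_iff relcomp_unfold)
  have sub: "y \<in> Domain (a ^^ Suc k) \<Longrightarrow> y \<in> Domain (a ^^ k)" for y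
    by auto
  have "(x, y) \<in> c (Suc k) \<longleftrightarrow> (x, y) \<in> c k \<and> y \<in> Domain (c k)" for x y
    using Dom[of y] sub[of y] unfolding c_iff by blast
  with relcomp_relcomp_converse_iff[OF \<open>single_valued ((c k)\<inverse>)\<close>] show ?thesis
    by (simp add: set_eq_iff split_paired_all)
qed

lemma nat_conj_k_Suc:
  assumes S: "inverse_subsemigroup n S" and conj: "nat_conj_k S k a b"
  shows "nat_conj_k S (Suc k) a b"
proof -
  have ab: "a \<in> S" "b \<in> S" using conj by (auto simp: nat_conj_k_def)
  then have "single_valued (a\<inverse>)" "single_valued (b\<inverse>)"
    using S by (auto simp: inverse_subsemigroup_def sym_inv_monoid_def)
  then show ?thesis
    using nat_conj_continuable[OF S] conj
    unfolding nat_conj_k_def by (simp only: relpow_converse_relpow_step simp_thms)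
qed

lemma nat_conj_k_mono:
  assumes "inverse_subsemigroup n S" and "k \<le> l" and "nat_conj_k S k a b"
  shows "nat_conj_k S l a b"
  using assms(2,3) by (induction rule: dec_induct) (auto intro: nat_conj_k_Suc[OF assms(1)])

lemma inverse_subsemigroup_sym_inv_monoid: "inverse_subsemigroup n (sym_inv_monoid n)"
  unfolding inverse_subsemigroup_def sym_inv_monoid_def
  by (auto simp: converse_relcomp intro: single_valued_relcomp)

lemma nat_conj_empty_iff:
  assumes "{} \<in> S"
  shows "nat_conj S (O) c {} \<longleftrightarrow> c = {}"
proof
  show "c = {}" if "nat_conj S (O) c {}"
    using that by (auto simp: nat_conj_relcomp_iff)
  have "carrier1 S (O) \<noteq> {}"
    using assms by (auto simp: carrier1_def)
  then show "nat_conj S (O) c {}" if "c = {}"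
    using that assms by (auto simp: nat_conj_relcomp_iff)
qed

definition chain :: "nat \<Rightarrow> (nat \<times> nat) set" where
  "chain m = {(x, Suc x) | x. 1 \<le> x \<and> x < m}"

lemma chain_mem_sym_inv_monoid: "chain m \<in> sym_inv_monoid m"
  by (auto simp: chain_def sym_inv_monoid_def single_valued_def)

lemma chain_relpow_bound: "(x, y) \<in> chain m ^^ k \<Longrightarrow> x \<le> m \<Longrightarrow> y = x + k \<and> y \<le> m"
  by (induction k arbitrary: y) (fastforce simp: chain_def)+

lemma chain_relpow_mem: "1 \<le> x \<Longrightarrow> x + k \<le> m \<Longrightarrow> (x, x + k) \<in> chain m ^^ k"
  by (induction k) (auto simp: chain_def intro!: relcompI)

text \<open>
  The path \<open>1 \<mapsto> \<dots> \<mapsto> m\<close> has \<open>m - 1\<close> arrows, and an arrow survives iff it is the first of \<open>k + 1\<close>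
  consecutive ones. The arrow \<open>(1, 2)\<close> leaves the most room, so it is the last to disappear.
\<close>

lemma chain_relpow_converse_relpow_eq_empty_iff:
  "chain m ^^ (k + 1) O ((chain m)\<inverse>) ^^ k = {} \<longleftrightarrow> m < k + 2"
proof -
  have sv: "single_valued ((chain m)\<inverse>)"
    by (auto simp: chain_def single_valued_def)
  note c_iff = relpow_Suc_converse_relpow_iff[OF sv]
  show ?thesis
  proof
    assume empty: "chain m ^^ (k + 1) O ((chain m)\<inverse>) ^^ k = {}"
    show "m < k + 2"
    proof (rule ccontr)
      assume "\<not> m < k + 2"
      then have "(1, 2) \<in> chain m" "(2, 2 + k) \<in> chain m ^^ k"
        using chain_relpow_mem[of 2 k m] by (simp_all add: chain_def)
      then have "(1, 2) \<in> chain m ^^ (k + 1) O ((chain m)\<inverse>) ^^ k"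
        unfolding c_iff by blast
      then show False using empty by blast
    qed
  next
    assume small: "m < k + 2"
    have False if "(x, y) \<in> chain m ^^ (k + 1) O ((chain m)\<inverse>) ^^ k" for x y
    proof -
      from that obtain z where "(x, y) \<in> chain m" "(y, z) \<in> chain m ^^ k"
        unfolding c_iff by blast
      moreover from this have "2 \<le> y" "y \<le> m" by (auto simp: chain_def)
      ultimately show False using chain_relpow_bound[of y z k m] small by simp
    qed
    then show "chain m ^^ (k + 1) O ((chain m)\<inverse>) ^^ k = {}" by auto
  qed
qed

lemma nat_conj_k_chain_empty_iff:
  "nat_conj_k (sym_inv_monoid m) k (chain m) {} \<longleftrightarrow> m < k + 2"
proof -
  have empty: "{} \<in> sym_inv_monoid m" by (auto simp: sym_inv_monoid_def)
  have zero: "({} :: (nat \<times> nat) set) ^^ (k + 1) O ({}\<inverse>) ^^ k = {}" by simp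
  show ?thesis
    unfolding nat_conj_k_def zero nat_conj_empty_iff[OF empty]
      chain_relpow_converse_relpow_eq_empty_iff
    using empty chain_mem_sym_inv_monoid by blast
qed

theorem theorem7p1:
  fixes i j :: nat
  assumes "1 \<le> i" and "i < j"
  shows "(\<forall>n\<ge>1. \<forall>S. inverse_subsemigroup n S \<longrightarrow>
            (\<forall>a\<in>S. \<forall>b\<in>S. nat_conj_k S i a b \<longrightarrow> nat_conj_k S j a b)) \<and>
         (\<exists>n\<ge>1. \<exists>S. inverse_subsemigroup n S \<and>
            (\<exists>a\<in>S. \<exists>b\<in>S. nat_conj_k S j a b \<and> \<not> nat_conj_k S i a b))"
proof
  show "\<forall>n\<ge>1. \<forall>S. inverse_subsemigroup n S \<longrightarrow>
            (\<forall>a\<in>S. \<forall>b\<in>S. nat_conj_k S i a b \<longrightarrow> nat_conj_k S j a b)"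
    using assms(2) nat_conj_k_mono[of _ _ i j] by (meson less_imp_le)
  have "nat_conj_k (sym_inv_monoid (i + 2)) j (chain (i + 2)) {}"
    and "\<not> nat_conj_k (sym_inv_monoid (i + 2)) i (chain (i + 2)) {}"
    using assms(2) by (simp_all only: nat_conj_k_chain_empty_iff)
  moreover have "1 \<le> i + 2" by simp
  moreover have "{} \<in> sym_inv_monoid (i + 2)"
    by (auto simp: sym_inv_monoid_def)
  ultimately show "\<exists>n\<ge>1. \<exists>S. inverse_subsemigroup n S \<and>
            (\<exists>a\<in>S. \<exists>b\<in>S. nat_conj_k S j a b \<and> \<not> nat_conj_k S i a b)"
    using inverse_subsemigroup_sym_inv_monoid chain_mem_sym_inv_monoid by blast
qed

end
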